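(* Let $K\subset\mathbb C^n$ be a non-pluripolar compact set, $\psi:K\to\mathbb R$ bounded, $m=\inf_K\psi$, $M=\sup_K\psi$, $a\in K$, and suppose $\tau\in\Lambda_{\mathrm{reg}}(a;K,\psi)$. The right derivative $$D_\tau(a)=\lim_{h\downarrow0}\frac{F_{\tau+h}(a)-\psi(a)}h$$ exists and is finite. The quotient $\frac{F_{\tau+h}(a)-\psi(a)}h$ is nonincreasing in $h>0$, and for every $h>0$ $$V_K^*(a)\le\frac{F_{\tau+h}(a)-\psi(a)}h\le D_\tau(a)\le\frac{\psi(a)-m}{\tau}.$$ Its limit as $h\to\infty$ is $V_K^*(a)$, with the error bound $$0\le\frac{F_{\tau+h}(a)-\psi(a)}h-V_K^*(a)\le\frac{M-m}{h}\qquad(h>0).$$ Moreover, $D_\tau(a)=V_K^*(a)$ if and only if $F_\delta(a)=\psi(a)+(\delta-\tau)V_K^*(a)$ for every $\delta\ge\tau$. One has $F_\delta(a)=\psi(a)$ for every $\delta>\tau$ if and only if $D_\tau(a)=0$. If $D_\tau(a)>0$, then $F_\delta(a)\neq\psi(a)$ for every $\delta>\tau$, and $\tau$ is the smallest element of $\Lambda(K,\psi)$.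
   Context: Write $\log^+t=\max\{\log t,0\}$, $\log^+0=0$; $\|\cdot\|$ is the Euclidean norm. For $\delta>0$, $\mathcal L_\delta=\{u\in \mathrm{PSH}(\mathbb C^n): u(z)\le\delta\log^+\|z\|+C_u \text{ on }\mathbb C^n\}$. $f^*(z)=\limsup_{\zeta\to z}f(\zeta)$ is the upper semicontinuous regularization. $V_{\delta,K,\psi}(z)=\sup\{u(z):u\in\mathcal L_\delta,\ u\le\psi\text{ on }K\}$, $F_\delta=V_{\delta,K,\psi}^*$, $V_K=V_{1,K,0}$. $\Lambda(K,\psi)=\{\delta>0:V_{\delta,K,\psi}|_K=\psi\}$ and $\Lambda_{\mathrm{reg}}(a;K,\psi)=\{\delta\in\Lambda(K,\psi):F_\delta(a)=\psi(a)\}$. It is known that a nonempty $\Lambda(K,\psi)$ is either $(0,\infty)$ or $[\lambda,\infty)$ for some $\lambda>0$. A set is pluripolar if near each point it is contained in the $-\infty$ locus of a plurisubharmonic function not identically $-\infty$. *)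

theory Defs
  imports "HOL-Analysis.Analysis"
begin

text \<open>
  Functions with values in \<open>[-\<infinity>, \<infinity>)\<close> are modelled as \<^typ>\<open>ereal\<close>-valued functions with an
  explicit condition excluding \<open>\<infinity>\<close>. A function on a set is a total function whose values
  outside the set play no role.
\<close>

text \<open>
  The Lebesgue integral of an extended real valued function over the circle of centre \<open>c\<close> and
  radius \<open>r\<close>, as the difference of the integrals of the positive and the negative part.
  \<^const>\<open>e2ennreal\<close> maps negative numbers to \<open>0\<close>. For an upper semicontinuous function not taking the
  value \<open>\<infinity>\<close> the first integral is finite, so that no \<open>\<infinity> - \<infinity>\<close> occurs.
\<close>

definition circle_mean :: "(complex \<Rightarrow> ereal) \<Rightarrow> complex \<Rightarrow> real \<Rightarrow> ereal" where
  "circle_mean f c r = ereal (1 / (2 * pi)) *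
     (enn2ereal (\<integral>\<^sup>+\<theta>\<in>{0..2*pi}. e2ennreal (f (c + of_real r * cis \<theta>)) \<partial>lborel) -
      enn2ereal (\<integral>\<^sup>+\<theta>\<in>{0..2*pi}. e2ennreal (- f (c + of_real r * cis \<theta>)) \<partial>lborel))"

definition usc_on :: "'a::topological_space set \<Rightarrow> ('a \<Rightarrow> ereal) \<Rightarrow> bool" where
  "usc_on S f \<longleftrightarrow> (\<forall>c. openin (top_of_set S) {z \<in> S. f z < c})"

text \<open>The constant function \<open>-\<infinity>\<close> counts as subharmonic and as plurisubharmonic.\<close>

definition subharmonic_on :: "complex set \<Rightarrow> (complex \<Rightarrow> ereal) \<Rightarrow> bool" where
  "subharmonic_on U f \<longleftrightarrow> open U \<and> (\<forall>z\<in>U. f z < \<infinity>) \<and> usc_on U f \<and>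
     (\<forall>c r. 0 < r \<and> cball c r \<subseteq> U \<longrightarrow> f c \<le> circle_mean f c r)"

definition psh_on :: "(complex ^ 'n) set \<Rightarrow> (complex ^ 'n \<Rightarrow> ereal) \<Rightarrow> bool" where
  "psh_on \<Omega> u \<longleftrightarrow> open \<Omega> \<and> (\<forall>z\<in>\<Omega>. u z < \<infinity>) \<and> usc_on \<Omega> u \<and>
     (\<forall>a b. subharmonic_on {\<zeta>. a + \<zeta> *s b \<in> \<Omega>} (\<lambda>\<zeta>. u (a + \<zeta> *s b)))"

text \<open>
  The neighbourhood is required to be connected: otherwise a function equal to \<open>-\<infinity>\<close> on only one
  of its components would make every set pluripolar.
\<close>

definition pluripolar :: "(complex ^ 'n) set \<Rightarrow> bool" where
  "pluripolar E \<longleftrightarrow> (\<forall>a\<in>E. \<exists>U v. open U \<and> connected U \<and> a \<in> U \<and> psh_on U v \<and>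
     (\<exists>z\<in>U. v z \<noteq> -\<infinity>) \<and> E \<inter> U \<subseteq> {z. v z = -\<infinity>})"

text \<open>Since \<open>ln 0 = 0\<close> in this library, the value at \<open>0\<close> is \<open>0\<close>.\<close>

definition log_plus :: "real \<Rightarrow> real" where
  "log_plus t = max (ln t) 0"

definition lelong_class :: "real \<Rightarrow> (complex ^ 'n \<Rightarrow> ereal) set" where
  "lelong_class \<delta> = {u. psh_on UNIV u \<and>
     (\<exists>C::real. \<forall>z. u z \<le> ereal (\<delta> * log_plus (norm z) + C))}"

text \<open>The upper limit is over full neighbourhoods, that is, \<open>\<zeta> = z\<close> is included.\<close>

definition usc_reg :: "('a::topological_space \<Rightarrow> ereal) \<Rightarrow> 'a \<Rightarrow> ereal" where
  "usc_reg f z = Limsup (nhds z) f"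

definition extremal_fun ::
  "real \<Rightarrow> (complex ^ 'n) set \<Rightarrow> (complex ^ 'n \<Rightarrow> real) \<Rightarrow> complex ^ 'n \<Rightarrow> ereal" where
  "extremal_fun \<delta> K \<psi> z = (SUP u \<in> {u \<in> lelong_class \<delta>. \<forall>w\<in>K. u w \<le> ereal (\<psi> w)}. u z)"

definition extremal_fun_reg ::
  "real \<Rightarrow> (complex ^ 'n) set \<Rightarrow> (complex ^ 'n \<Rightarrow> real) \<Rightarrow> complex ^ 'n \<Rightarrow> ereal" where
  "extremal_fun_reg \<delta> K \<psi> = usc_reg (extremal_fun \<delta> K \<psi>)"

definition siciak_fun :: "(complex ^ 'n) set \<Rightarrow> complex ^ 'n \<Rightarrow> ereal" where
  "siciak_fun K = extremal_fun 1 K (\<lambda>_. 0)"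

definition Lambda_set :: "(complex ^ 'n) set \<Rightarrow> (complex ^ 'n \<Rightarrow> real) \<Rightarrow> real set" where
  "Lambda_set K \<psi> = {\<delta>. 0 < \<delta> \<and> (\<forall>z\<in>K. extremal_fun \<delta> K \<psi> z = ereal (\<psi> z))}"

definition Lambda_reg ::
  "complex ^ 'n \<Rightarrow> (complex ^ 'n) set \<Rightarrow> (complex ^ 'n \<Rightarrow> real) \<Rightarrow> real set" where
  "Lambda_reg a K \<psi> = {\<delta> \<in> Lambda_set K \<psi>. extremal_fun_reg \<delta> K \<psi> a = ereal (\<psi> a)}"

definition extremal_quotient ::
  "real \<Rightarrow> complex ^ 'n \<Rightarrow> (complex ^ 'n) set \<Rightarrow> (complex ^ 'n \<Rightarrow> real) \<Rightarrow> real \<Rightarrow> ereal" where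
  "extremal_quotient \<tau> a K \<psi> h = (extremal_fun_reg (\<tau> + h) K \<psi> a - ereal (\<psi> a)) / ereal h"

text \<open>\<^const>\<open>Lim\<close> is a definite description, so existence of the limit has to be stated separately.\<close>

definition extremal_right_deriv ::
  "real \<Rightarrow> complex ^ 'n \<Rightarrow> (complex ^ 'n) set \<Rightarrow> (complex ^ 'n \<Rightarrow> real) \<Rightarrow> ereal" where
  "extremal_right_deriv \<tau> a K \<psi> = Lim (at_right 0) (extremal_quotient \<tau> a K \<psi>)"

end

theory Submission
  imports Defs
begin

text \<open>
  Everything follows from the concavity of \<open>\<delta> \<mapsto> F\<^sub>\<delta>(a)\<close> on \<open>(0, \<infinity>)\<close> together with a few
  inequalities obtained by combining competitors. The quotient in the theorem is the slope of
  this function between \<open>\<tau>\<close> and \<open>\<tau> + h\<close>, so it is nonincreasing in \<open>h\<close>; it is bounded, so its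
  supremum is finite and is the right derivative.

  The bounds come from explicit competitors. Adding \<open>h\<close> times a competitor for \<open>V\<^sub>K\<close> to one
  for growth \<open>\<tau>\<close> gives the lower bound \<open>V\<^sub>K\<^sup>*(a)\<close> of the slopes. Mixing a competitor for growth
  \<open>\<tau> + h\<close> with the constant \<open>m\<close>, which has growth \<open>0\<close>, gives one for growth \<open>\<tau>\<close>; this yields the upper
  bound \<open>(\<psi>(a) - m) / \<tau>\<close> and the finiteness of all values. Finally, \<open>(u - M) / (\<tau> + h)\<close> competes for \<open>V\<^sub>K\<close>
  and \<open>\<tau> v + m\<close> competes for growth \<open>\<tau>\<close>, which together give the error bound \<open>(M - m) / h\<close>.
  The remaining assertions are elementary facts on a nondecreasing concave function and its
  slopes.

  Combining competitors gives these inequalities for the suprema, before regularization. The point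
  of substance is that they survive it: upper semicontinuous regularization does not
  preserve superadditivity in general. It does for plurisubharmonic families because a plurisubharmonic function lies below
  its averages over balls. If \<open>f\<close> is the supremum of a family that is bounded above near \<open>a\<close>, then
  \<open>f\<^sup>*(a)\<close> is the limit, as \<open>r\<close> tends to \<open>0\<close>, of the supremum over the family of the averages over the
  ball of radius \<open>r\<close> around \<open>a\<close>: a value at a point near \<open>a\<close> is below the average over a
  ball around that point, which differs little from the ball around \<open>a\<close>, while averages near \<open>a\<close>
  are bounded by \<open>sup f\<close> near \<open>a\<close>. Averages are linear in \<open>u\<close>, so superadditivity passes to the
  regularizations. The lemma \<open>ball_deficit_pair\<close> carries out this comparison for a pair of functions,
  and \<open>usc_reg_Sup_superadditive\<close> passes to the limit.
\<close>

section \<open>Upper semicontinuous functions\<close>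

lemma usc_on_UNIV_iff:
  "usc_on UNIV f \<longleftrightarrow> (\<forall>x c. f x < c \<longrightarrow> (\<forall>\<^sub>F y in nhds x. f y < c))"
proof
  assume "usc_on UNIV f"
  then have "open {z. f z < c}" for c
    by (auto simp: usc_on_def)
  then show "\<forall>x c. f x < c \<longrightarrow> (\<forall>\<^sub>F y in nhds x. f y < c)"
    by (fastforce simp: eventually_nhds)
next
  assume "\<forall>x c. f x < c \<longrightarrow> (\<forall>\<^sub>F y in nhds x. f y < c)"
  then have "open {z. f z < c}" for c
    unfolding eventually_nhds by (subst open_subopen) (fastforce)
  then show "usc_on UNIV f"
    by (auto simp: usc_on_def)
qed

lemma usc_on_UNIV_open: "usc_on UNIV f \<Longrightarrow> open {z. f z < c}"
  by (auto simp: usc_on_def)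

lemma usc_on_UNIV_measurable:
  assumes "usc_on UNIV f"
  shows "f \<in> borel_measurable borel"
  by (rule borel_measurableI_less) (use usc_on_UNIV_open[OF assms] in auto)

lemma usc_on_UNIV_cmult:
  fixes c :: real
  assumes "usc_on UNIV f" "0 \<le> c"
  shows "usc_on UNIV (\<lambda>x. ereal c * f x)"
proof (cases "c = 0")
  case True
  then show ?thesis by (auto simp: usc_on_def zero_ereal_def[symmetric])
next
  case False
  then have "ereal c * f x < d \<longleftrightarrow> f x < d / ereal c" for x d
    using assms(2) by (subst ereal_less_divide_pos) (auto simp: mult.commute)
  then show ?thesis using assms(1) by (simp add: usc_on_def)
qed

text \<open>
  An interpolation that turns the usual argument for sums of upper semicontinuous functions into one
  for values in \<open>[-\<infinity>, \<infinity>)\<close>: addition is continuous away from \<open>\<infinity> - \<infinity>\<close>, so \<open>x\<close> and \<open>y\<close> can both be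
  enlarged a little.
\<close>

lemma ereal_add_less_split:
  fixes x y c :: ereal
  assumes "x + y < c" "x < \<infinity>" "y < \<infinity>"
  obtains p q where "x < p" "y < q" "p + q \<le> c"
proof -
  obtain d :: real where d: "x + y < ereal d" "ereal d < c"
    using ereal_dense2[OF assms(1)] by auto
  show thesis
  proof (cases "y = -\<infinity>")
    case False
    then obtain b where b: "y = ereal b" using assms(3) by (cases y) auto
    have "x < ereal (d - b)" using d(1) assms(2) b by (cases x) auto
    then obtain e where e: "x < ereal e" "ereal e < ereal (d - b)" using ereal_dense2 by blast
    show thesis
      by (rule that[of "ereal e" "ereal (d - e)"]) (use e d b in \<open>auto simp: less_imp_le\<close>)
  next
    case True
    obtain e where e: "x < ereal e" using assms(2) ereal_dense2 by blast
    show thesis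
      by (rule that[of "ereal e" "ereal (d - e)"]) (use True e d in \<open>auto simp: less_imp_le\<close>)
  qed
qed

lemma usc_on_UNIV_add:
  assumes "usc_on UNIV f" "usc_on UNIV g" "\<And>x. f x < \<infinity>" "\<And>x. g x < \<infinity>"
  shows "usc_on UNIV (\<lambda>x. f x + g x)"
  unfolding usc_on_UNIV_iff
proof (intro allI impI)
  fix x c assume "f x + g x < c"
  then obtain p q where pq: "f x < p" "g x < q" "p + q \<le> c"
    using ereal_add_less_split assms(3,4) by metis
  have "\<forall>\<^sub>F y in nhds x. f y < p" "\<forall>\<^sub>F y in nhds x. g y < q"
    using assms(1,2) pq by (auto simp: usc_on_UNIV_iff)
  then show "\<forall>\<^sub>F y in nhds x. f y + g y < c"
  proof eventually_elim
    case (elim y)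
    then have "f y + g y < p + q" by (rule ereal_add_strict_mono2)
    with pq(3) show ?case by order
  qed
qed

lemma usc_on_UNIV_bounded_on_compact:
  assumes "usc_on UNIV f" "\<And>x. f x < \<infinity>" "compact S"
  obtains C :: real where "0 \<le> C" "\<And>x. x \<in> S \<Longrightarrow> f x \<le> ereal C"
proof -
  have cover: "S \<subseteq> (\<Union>n. {z. f z < ereal (real n)})"
  proof
    fix x
    obtain n :: nat where "f x < ereal (real n)"
      using less_PInf_Ex_of_nat[of "f x"] assms(2)[of x] by auto
    then show "x \<in> (\<Union>n. {z. f z < ereal (real n)})" by auto
  qed
  obtain N where N: "finite N" "S \<subseteq> (\<Union>n\<in>N. {z. f z < ereal (real n)})"
    using compactE_image[OF assms(3) _ cover] usc_on_UNIV_open[OF assms(1)] by metis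
  show thesis
  proof (rule that[of "real (Max (insert 0 N))"])
    fix x assume "x \<in> S"
    then obtain n where n: "n \<in> N" "f x < ereal (real n)" using N by auto
    have "n \<le> Max (insert 0 N)" using N n by (simp add: Max_ge)
    then have "ereal (real n) \<le> ereal (real (Max (insert 0 N)))" by simp
    with n show "f x \<le> ereal (real (Max (insert 0 N)))" by order
  qed simp
qed

section \<open>Circle means and nonnegative deficits\<close>

text \<open>
  For a function \<open>f \<le> C\<close> the deficit \<open>C - f\<close> is nonnegative, so its integral needs no splitting into
  a positive and a negative part. The following identity between \<open>f\<^sup>+\<close>, \<open>f\<^sup>-\<close> and the deficit
  expresses the circle mean by that one integral. This removes all differences of infinite integrals
  and reduces submean inequalities to additivity of nonnegative integrals.
\<close>

lemma e2ennreal_decompose: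
  assumes "x \<le> ereal C" "0 \<le> C"
  shows "e2ennreal (ereal C - x) + e2ennreal x = ennreal C + e2ennreal (- x)"
proof (cases x)
  case (real r)
  then show ?thesis using assms
    by (cases "0 \<le> r") (auto simp: ennreal_plus[symmetric] ennreal.rep_eq ennreal_neg simp flip: ennreal.abs_eq simp del: ennreal_plus)
qed (use assms in \<open>auto simp: e2ennreal_infty e2ennreal_neg\<close>)

lemma circle_mean_eq:
  assumes meas: "f \<in> borel_measurable borel"
    and C: "0 \<le> C" "\<And>\<theta>. f (c + of_real r * cis \<theta>) \<le> ereal C"
  shows "circle_mean f c r = ereal C - ereal (1 / (2 * pi)) *
    enn2ereal (\<integral>\<^sup>+\<theta>\<in>{0..2*pi}. e2ennreal (ereal C - f (c + of_real r * cis \<theta>)) \<partial>lborel)"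
proof -
  define g where "g \<theta> = f (c + of_real r * cis \<theta>)" for \<theta>
  have [measurable]: "g \<in> borel_measurable borel"
    unfolding g_def using meas
    by (rule measurable_compose[rotated]) (intro borel_measurable_continuous_onI continuous_intros)
  define I where "I = (\<integral>\<^sup>+\<theta>\<in>{0..2*pi}. e2ennreal (ereal C - g \<theta>) \<partial>lborel)"
  define P where "P = (\<integral>\<^sup>+\<theta>\<in>{0..2*pi}. e2ennreal (g \<theta>) \<partial>lborel)"
  define N where "N = (\<integral>\<^sup>+\<theta>\<in>{0..2*pi}. e2ennreal (- g \<theta>) \<partial>lborel)"
  have const: "(\<integral>\<^sup>+\<theta>\<in>{0..2*pi}. ennreal C \<partial>lborel) = ennreal (2 * pi * C)"
    using C(1) by (simp add: nn_integral_cmult_indicator ennreal_mult[symmetric] mult.commute)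
  have "I + P = (\<integral>\<^sup>+\<theta>\<in>{0..2*pi}. (e2ennreal (ereal C - g \<theta>) + e2ennreal (g \<theta>)) \<partial>lborel)"
    unfolding I_def P_def distrib_right by (rule nn_integral_add[symmetric]) auto
  also have "\<dots> = (\<integral>\<^sup>+\<theta>\<in>{0..2*pi}. (ennreal C + e2ennreal (- g \<theta>)) \<partial>lborel)"
    using C by (simp add: e2ennreal_decompose g_def)
  also have "\<dots> = ennreal (2 * pi * C) + N"
    unfolding N_def distrib_right const[symmetric] by (rule nn_integral_add) auto
  finally have eq: "I + P = ennreal (2 * pi * C) + N" .
  have "P \<le> (\<integral>\<^sup>+\<theta>\<in>{0..2*pi}. ennreal C \<partial>lborel)"
    unfolding P_def using C(2) e2ennreal_mono[OF C(2)]
    by (intro nn_integral_mono mult_right_mono) (auto simp: g_def ennreal.abs_eq)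
  also note const
  finally have "P < \<infinity>" by (auto simp: top_unique less_top[symmetric])
  then obtain p where p: "0 \<le> p" "P = ennreal p" by (cases P) auto
  have "circle_mean f c r = ereal (1 / (2 * pi)) * (enn2ereal P - enn2ereal N)"
    by (simp add: circle_mean_def P_def N_def g_def)
  also have "\<dots> = ereal C - ereal (1 / (2 * pi)) * enn2ereal I"
  proof (cases N)
    case (real n)
    then have "I \<noteq> top" using eq by (metis ennreal_add_eq_top ennreal_neq_top)
    then obtain i where i: "0 \<le> i" "I = ennreal i" by (cases I) auto
    have "i + p = 2 * pi * C + n"
      using eq i p real C(1) by (simp add: ennreal_plus[symmetric] del: ennreal_plus)
    then show ?thesis using i p real by (simp add: enn2ereal_ennreal field_simps)
  next
    case top
    then have "I = top" using eq p by (metis ennreal_add_eq_top ennreal_neq_top)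
    with top p show ?thesis by (simp add: enn2ereal_ennreal)
  qed
  finally show ?thesis by (simp add: I_def g_def)
qed

section \<open>Combinations of plurisubharmonic functions\<close>

lemma subharmonic_on_UNIV_mean:
  assumes "subharmonic_on UNIV f" "0 < r" "0 \<le> C" "\<And>\<theta>. f (c + of_real r * cis \<theta>) \<le> ereal C"
  shows "f c \<le> ereal C - ereal (1 / (2 * pi)) *
    enn2ereal (\<integral>\<^sup>+\<theta>\<in>{0..2*pi}. e2ennreal (ereal C - f (c + of_real r * cis \<theta>)) \<partial>lborel)"
proof -
  have "f \<in> borel_measurable borel"
    using assms(1) by (auto simp: subharmonic_on_def intro: usc_on_UNIV_measurable)
  then show ?thesis
    using circle_mean_eq[OF _ assms(3), of f c r] assms(4)
    by (metis UNIV_I assms(1,2) subharmonic_on_def subset_UNIV)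
qed

lemma ereal_affine_combination:
  fixes c1 c2 C1 C2 :: real and x y :: ereal
  assumes "0 \<le> c1" "0 \<le> c2" "x < \<infinity>" "y < \<infinity>"
  shows "ereal c1 * (ereal C1 - x) + ereal c2 * (ereal C2 - y) =
    ereal (c1 * C1 + c2 * C2) - (ereal c1 * x + ereal c2 * y)"
  using assms by (cases x; cases y; cases "c1 = 0"; cases "c2 = 0") (auto simp: algebra_simps)

lemma ereal_combination_mono:
  fixes c1 c2 :: real and x y :: ereal
  assumes "0 \<le> c1" "0 \<le> c2" "x \<le> x'" "y \<le> y'"
  shows "ereal c1 * x + ereal c2 * y \<le> ereal c1 * x' + ereal c2 * y'"
  using assms by (intro add_mono ereal_mult_left_mono) auto

lemma ereal_combination_less_top:
  fixes c1 c2 :: real and x y :: ereal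
  assumes "0 \<le> c1" "0 \<le> c2" "x < \<infinity>" "y < \<infinity>"
  shows "ereal c1 * x + ereal c2 * y < \<infinity>"
  using assms by (cases x; cases y; cases "c1 = 0"; cases "c2 = 0") auto

lemma enn2ereal_combination:
  fixes c1 c2 :: real and x y :: ennreal
  assumes "0 \<le> c1" "0 \<le> c2"
  shows "enn2ereal (ennreal c1 * x + ennreal c2 * y) = ereal c1 * enn2ereal x + ereal c2 * enn2ereal y"
  using assms by (simp add: plus_ennreal.rep_eq times_ennreal.rep_eq enn2ereal_ennreal)

lemma e2ennreal_combination:
  fixes c1 c2 :: real and x y :: ereal
  assumes "0 \<le> c1" "0 \<le> c2" "0 \<le> x" "0 \<le> y"
  shows "e2ennreal (ereal c1 * x + ereal c2 * y) = ennreal c1 * e2ennreal x + ennreal c2 * e2ennreal y"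
  using enn2ereal_combination[OF assms(1,2), of "e2ennreal x" "e2ennreal y"] assms(3,4)
  by (metis e2ennreal_enn2ereal enn2ereal_e2ennreal)

text \<open>
  The deficit of a combination, relative to the combined bound, is the combination of the deficits.
  Additivity of means over circles and over balls both come from here.
\<close>

lemma e2ennreal_deficit_combination:
  fixes c1 c2 C1 C2 :: real and x y :: ereal
  assumes "0 \<le> c1" "0 \<le> c2" "x \<le> ereal C1" "y \<le> ereal C2"
  shows "e2ennreal (ereal (c1 * C1 + c2 * C2) - (ereal c1 * x + ereal c2 * y)) =
    ennreal c1 * e2ennreal (ereal C1 - x) + ennreal c2 * e2ennreal (ereal C2 - y)"
proof -
  have "x < \<infinity>" "y < \<infinity>" using assms by (auto simp: less_top[symmetric] top_ereal_def)
  then show ?thesis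
    using assms
    by (subst ereal_affine_combination[symmetric], simp_all, subst e2ennreal_combination)
      (auto simp: ereal_diff_positive)
qed

text \<open>
  A bound for each function on the circle exists by compactness; after passing to deficits the two
  submean inequalities simply add up.
\<close>

lemma subharmonic_on_UNIV_combination:
  fixes c1 c2 :: real
  assumes f: "subharmonic_on UNIV f" and g: "subharmonic_on UNIV g" and c: "0 \<le> c1" "0 \<le> c2"
  shows "subharmonic_on UNIV (\<lambda>z. ereal c1 * f z + ereal c2 * g z)"
proof -
  have top: "f z < \<infinity>" "g z < \<infinity>" for z
    using f g by (auto simp: subharmonic_on_def)
  have usc: "usc_on UNIV f" "usc_on UNIV g"
    using f g by (auto simp: subharmonic_on_def)
  define s where "s z = ereal c1 * f z + ereal c2 * g z" for z
  have usc_s: "usc_on UNIV s" unfolding s_def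
    by (intro usc_on_UNIV_add usc_on_UNIV_cmult usc c) (use top c in \<open>auto simp: ereal_mult_less_0_iff less_top[symmetric] top_ereal_def ereal_mult_eq_PInfty\<close>)
  have "s z \<le> circle_mean s z r" if r: "0 < r" for z r
  proof -
    define w where "w \<theta> = z + of_real r * cis \<theta>" for \<theta>
    have [measurable]: "w \<in> borel_measurable borel"
      unfolding w_def by (intro borel_measurable_continuous_onI continuous_intros)
    have [measurable]: "f \<in> borel_measurable borel" "g \<in> borel_measurable borel"
      using usc usc_on_UNIV_measurable by auto
    have circle: "w \<theta> \<in> sphere z r" for \<theta>
      using r by (simp add: w_def dist_norm norm_mult)
    obtain C1 where C1: "0 \<le> C1" "\<And>x. x \<in> sphere z r \<Longrightarrow> f x \<le> ereal C1"
      using usc_on_UNIV_bounded_on_compact[OF usc(1) top(1) compact_sphere] by metis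
    obtain C2 where C2: "0 \<le> C2" "\<And>x. x \<in> sphere z r \<Longrightarrow> g x \<le> ereal C2"
      using usc_on_UNIV_bounded_on_compact[OF usc(2) top(2) compact_sphere] by metis
    define C where "C = c1 * C1 + c2 * C2"
    define I1 where "I1 = (\<integral>\<^sup>+\<theta>\<in>{0..2*pi}. e2ennreal (ereal C1 - f (w \<theta>)) \<partial>lborel)"
    define I2 where "I2 = (\<integral>\<^sup>+\<theta>\<in>{0..2*pi}. e2ennreal (ereal C2 - g (w \<theta>)) \<partial>lborel)"
    have "(\<integral>\<^sup>+\<theta>\<in>{0..2*pi}. e2ennreal (ereal C - s (w \<theta>)) \<partial>lborel) =
      (\<integral>\<^sup>+\<theta>. ennreal c1 * (e2ennreal (ereal C1 - f (w \<theta>)) * indicator {0..2*pi} \<theta>) +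
        ennreal c2 * (e2ennreal (ereal C2 - g (w \<theta>)) * indicator {0..2*pi} \<theta>) \<partial>lborel)"
      unfolding C_def s_def
      using e2ennreal_deficit_combination[OF c C1(2)[OF circle] C2(2)[OF circle]]
      by (simp add: distrib_right mult.assoc)
    also have "\<dots> = ennreal c1 * I1 + ennreal c2 * I2"
      unfolding I1_def I2_def
      by (subst nn_integral_add) (auto simp: nn_integral_cmult)
    finally have I: "(\<integral>\<^sup>+\<theta>\<in>{0..2*pi}. e2ennreal (ereal C - s (w \<theta>)) \<partial>lborel) =
      ennreal c1 * I1 + ennreal c2 * I2" .
    have fin: "ereal (1 / (2 * pi)) * enn2ereal I1 \<ge> 0" "ereal (1 / (2 * pi)) * enn2ereal I2 \<ge> 0"
      by auto
    have s_le: "s (w \<theta>) \<le> ereal C" for \<theta>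
      using ereal_combination_mono[OF c C1(2)[OF circle] C2(2)[OF circle]] by (simp add: s_def C_def)
    have "s z \<le> ereal c1 * (ereal C1 - ereal (1 / (2 * pi)) * enn2ereal I1) +
        ereal c2 * (ereal C2 - ereal (1 / (2 * pi)) * enn2ereal I2)"
      unfolding s_def I1_def I2_def w_def
      by (intro ereal_combination_mono c subharmonic_on_UNIV_mean f g r C1 C2)
        (use circle in \<open>auto simp: w_def\<close>)
    also have "\<dots> = ereal C - ereal (1 / (2 * pi)) * (ereal c1 * enn2ereal I1 + ereal c2 * enn2ereal I2)"
      using c by (cases I1; cases I2; cases "c1 = 0"; cases "c2 = 0")
        (auto simp: enn2ereal_ennreal C_def field_simps)
    also have "\<dots> = circle_mean s z r"
      using circle_mean_eq[OF usc_on_UNIV_measurable[OF usc_s], of C z r] I s_le c C1(1) C2(1)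
      by (simp add: enn2ereal_combination C_def w_def)
    finally show ?thesis .
  qed
  then show ?thesis
    using usc_s top c unfolding subharmonic_on_def s_def
    by (auto intro: ereal_combination_less_top)
qed

lemma psh_on_UNIV_combination:
  fixes u v :: "complex ^ 'n \<Rightarrow> ereal" and c1 c2 :: real
  assumes u: "psh_on UNIV u" and v: "psh_on UNIV v" and c: "0 \<le> c1" "0 \<le> c2"
  shows "psh_on UNIV (\<lambda>z. ereal c1 * u z + ereal c2 * v z)"
proof -
  have top: "u z < \<infinity>" "v z < \<infinity>" for z
    using u v by (auto simp: psh_on_def)
  have "usc_on UNIV (\<lambda>z. ereal c1 * u z + ereal c2 * v z)"
    using u v c by (intro usc_on_UNIV_add usc_on_UNIV_cmult)
      (auto simp: psh_on_def less_top[symmetric] top_ereal_def ereal_mult_eq_PInfty)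
  then show ?thesis
    using u v c top ereal_combination_less_top subharmonic_on_UNIV_combination
    unfolding psh_on_def by auto
qed

lemma psh_on_UNIV_const: "psh_on UNIV (\<lambda>z :: complex ^ 'n. ereal k)"
proof -
  have usc: "usc_on UNIV (\<lambda>z :: 'b :: topological_space. ereal k)"
    by (simp add: usc_on_def)
  have "ereal k \<le> circle_mean (\<lambda>_. ereal k) c r" for c r
  \<comment> \<open>the bound in \<open>circle_mean_eq\<close> must be nonnegative, so \<open>C = k\<close> serves only for \<open>k \<ge> 0\<close>\<close>
  proof (cases "0 \<le> k")
    case True
    then show ?thesis by (subst circle_mean_eq[where C = k]) (auto simp: e2ennreal_neg zero_ennreal.rep_eq)
  next
    case False
    then show ?thesis
      by (subst circle_mean_eq[where C = 0])
        (auto simp: nn_integral_cmult_indicator e2ennreal_ereal enn2ereal_ennreal times_ennreal.rep_eq mult_le_0_iff simp flip: ennreal_mult'' zero_ereal_def)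
  qed
  then show ?thesis using usc by (simp add: psh_on_def subharmonic_on_def usc_on_def)
qed

section \<open>Averages over balls\<close>

lemma norm_vector_smult_complex:
  fixes y :: "complex ^ 'n"
  shows "norm (c *s y) = cmod c * norm y"
  by (simp add: norm_vec_def L2_set_def norm_mult power_mult_distrib sum_distrib_left[symmetric]
      real_sqrt_mult)

lemma continuous_on_vector_smult [continuous_intros]:
  fixes f :: "'a :: topological_space \<Rightarrow> complex" and g :: "'a \<Rightarrow> complex ^ 'n"
  assumes "continuous_on S f" "continuous_on S g"
  shows "continuous_on S (\<lambda>x. f x *s g x)"
  unfolding vector_scalar_mult_def
  by (intro continuous_intros assms)

lemma borel_measurable_vector_smult [measurable (raw)]:
  fixes f :: "'a \<Rightarrow> complex" and g :: "'a \<Rightarrow> complex ^ 'n"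
  assumes "f \<in> borel_measurable M" "g \<in> borel_measurable M"
  shows "(\<lambda>x. f x *s g x) \<in> borel_measurable M"
  by (rule borel_measurable_continuous_Pair[OF assms]) (intro continuous_intros)

lemma borel_measurable_cis [measurable]: "cis \<in> borel_measurable borel"
  by (intro borel_measurable_continuous_onI continuous_intros)

lemma ball_measurable [measurable]: "ball (x :: 'a :: {second_countable_topology, metric_space}) r \<in> sets borel"
  by simp

text \<open>
  The deficit of \<open>u\<close> below \<open>C\<close>, integrated over the ball of centre \<open>z\<close> and radius \<open>r\<close> and then over all
  rotations of that ball by \<open>cis \<theta>\<close>. By rotation invariance this is \<open>2\<pi>\<close> times the integral over the
  ball. Keeping the rotations inside the definition makes the submean inequality a matter of
  exchanging two integrals: for fixed \<open>y\<close> the points \<open>z + cis \<theta> *s y\<close> run through a circle in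
  a complex line.
\<close>

definition ball_deficit ::
  "real \<Rightarrow> (complex ^ 'n \<Rightarrow> ereal) \<Rightarrow> complex ^ 'n \<Rightarrow> real \<Rightarrow> ennreal" where
  "ball_deficit C u z r = (\<integral>\<^sup>+\<theta>\<in>{0..2*pi}.
     (\<integral>\<^sup>+y\<in>ball 0 r. e2ennreal (ereal C - u (z + cis \<theta> *s y)) \<partial>lborel) \<partial>lborel)"

text \<open>
  The ball of radius \<open>r\<close> around \<open>z\<close> lies in the ball of radius \<open>r'\<close> around \<open>z'\<close>, and the integrand is
  nonnegative. For each rotation the inclusion is a translation of
  the variable \<open>y\<close>. This comparison lets one centre stand in for all nearby ones.
\<close>

lemma ball_deficit_mono:
  fixes z z' :: "complex ^ 'n"
  assumes u [measurable]: "u \<in> borel_measurable borel" and r: "r + dist z z' \<le> r'"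
  shows "ball_deficit C u z r \<le> ball_deficit C u z' r'"
  unfolding ball_deficit_def
proof (rule nn_integral_mono, rule mult_right_mono)
  fix \<theta> :: real
  \<comment> \<open>the shift from \<open>z\<close> to \<open>z'\<close>, seen in the rotated coordinate \<open>y\<close>\<close>
  define d where "d = cis (- \<theta>) *s (z' - z)"
  have d: "cis \<theta> *s d = z' - z" "norm d = dist z z'"
    unfolding d_def norm_vector_smult_complex vector_smult_assoc cis_mult dist_norm
    by (simp_all add: norm_minus_commute)
  define g where "g y = e2ennreal (ereal C - u (z + cis \<theta> *s y))" for y
  have [measurable]: "g \<in> borel_measurable borel" unfolding g_def by measurable
  have "(\<integral>\<^sup>+y\<in>ball 0 r. g y \<partial>lborel) = (\<integral>\<^sup>+y. g y * indicator (ball 0 r) y \<partial>distr lborel borel ((+) d))"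
    by (simp add: lborel_distr_plus)
  also have "\<dots> = (\<integral>\<^sup>+y. g (d + y) * indicator (ball 0 r) (d + y) \<partial>lborel)"
    by (rule nn_integral_distr) auto
  also have "\<dots> \<le> (\<integral>\<^sup>+y\<in>ball 0 r'. e2ennreal (ereal C - u (z' + cis \<theta> *s y)) \<partial>lborel)"
  proof (rule nn_integral_mono, rule mult_mono)
    fix y
    have "g (d + y) = e2ennreal (ereal C - u (z + (cis \<theta> *s d + cis \<theta> *s y)))"
      by (simp add: g_def vector_add_ldistrib)
    then show "g (d + y) \<le> e2ennreal (ereal C - u (z' + cis \<theta> *s y))"
      unfolding d by simp
    have "norm y \<le> norm (d + y) + norm d"
      by (metis add_diff_cancel_left' norm_triangle_ineq4)
    then show "indicator (ball 0 r) (d + y) \<le> (indicator (ball 0 r') y :: ennreal)"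
      using r d(2) by (auto simp: indicator_def)
  qed auto
  finally show "(\<integral>\<^sup>+y\<in>ball 0 r. e2ennreal (ereal C - u (z + cis \<theta> *s y)) \<partial>lborel) \<le>
      (\<integral>\<^sup>+y\<in>ball 0 r'. e2ennreal (ereal C - u (z' + cis \<theta> *s y)) \<partial>lborel)"
    by (simp add: g_def)
qed auto

text \<open>
  The submean inequality on balls: on each circle \<open>{z + cis \<theta> *s y}\<close> it is subharmonicity along a
  complex line, and integrating over \<open>y\<close> gives the claim after Tonelli's theorem.
\<close>

lemma ball_deficit_le:
  fixes u :: "complex ^ 'n \<Rightarrow> ereal"
  assumes u: "psh_on UNIV u" and C: "0 \<le> C" "\<And>w. w \<in> ball z r \<Longrightarrow> u w \<le> ereal C"
    and fin: "u z \<noteq> -\<infinity>" and r: "0 < r"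
  shows "ball_deficit C u z r \<le> ennreal (2 * pi * measure lborel (ball (0 :: complex ^ 'n) r)) * e2ennreal (ereal C - u z)"
proof -
  have [measurable]: "u \<in> borel_measurable borel"
    using u by (auto simp: psh_on_def intro: usc_on_UNIV_measurable)
  have uz: "u z \<le> ereal C" using C(2) r by simp
  obtain x where x: "u z = ereal x" "x \<le> C" using uz fin by (cases "u z") auto
  have line: "(\<integral>\<^sup>+\<theta>\<in>{0..2*pi}. e2ennreal (ereal C - u (z + cis \<theta> *s y)) \<partial>lborel) \<le>
      ennreal (2 * pi * (C - x))" if y: "y \<in> ball 0 r" for y
  proof -
    have sub: "subharmonic_on UNIV (\<lambda>\<zeta>. u (z + \<zeta> *s y))"
      using u by (simp add: psh_on_def)
    have "u (z + cis \<theta> *s y) \<le> ereal C" for \<theta>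
      using y by (intro C(2)) (auto simp: dist_norm norm_vector_smult_complex)
    then have le: "ereal x \<le> ereal C - ereal (1 / (2 * pi)) * 
        enn2ereal (\<integral>\<^sup>+\<theta>\<in>{0..2*pi}. e2ennreal (ereal C - u (z + cis \<theta> *s y)) \<partial>lborel)"
      (is "_ \<le> _ - _ * enn2ereal ?I")
      using subharmonic_on_UNIV_mean[OF sub, of 1 C 0] C(1) x by simp
    show ?thesis
    proof (cases ?I)
      case (real i)
      then have "i \<le> 2 * pi * (C - x)"
        using le by (simp add: enn2ereal_ennreal field_simps)
      then show ?thesis using real by (simp add: ennreal_leI)
    next
      case top
      then show ?thesis using le by simp
    qed
  qed
  have "ball_deficit C u z r = (\<integral>\<^sup>+\<theta>. (\<integral>\<^sup>+y. e2ennreal (ereal C - u (z + cis \<theta> *s y)) *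
      indicator (ball 0 r) y * indicator {0..2*pi} \<theta> \<partial>lborel) \<partial>lborel)"
    unfolding ball_deficit_def
    by (intro nn_integral_cong nn_integral_multc[symmetric]) measurable
  also have "\<dots> = (\<integral>\<^sup>+y. (\<integral>\<^sup>+\<theta>. e2ennreal (ereal C - u (z + cis \<theta> *s y)) *
      indicator (ball 0 r) y * indicator {0..2*pi} \<theta> \<partial>lborel) \<partial>lborel)"
    by (rule lborel_pair.Fubini'[symmetric]) measurable
  also have "\<dots> \<le> (\<integral>\<^sup>+y\<in>ball 0 r. ennreal (2 * pi * (C - x)) \<partial>(lborel :: (complex ^ 'n) measure))"
  proof (intro nn_integral_mono)
    fix y :: "complex ^ 'n"
    show "(\<integral>\<^sup>+\<theta>. e2ennreal (ereal C - u (z + cis \<theta> *s y)) * indicator (ball 0 r) y * indicator {0..2*pi} \<theta> \<partial>lborel)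
      \<le> ennreal (2 * pi * (C - x)) * indicator (ball 0 r) y"
      using line[of y] by (cases "y \<in> ball 0 r") auto
  qed
  also have "\<dots> = ennreal (2 * pi * measure lborel (ball (0 :: complex ^ 'n) r)) * e2ennreal (ereal C - u z)"
    using x emeasure_lborel_ball_finite[of "0 :: complex ^ 'n" r]
    by (subst nn_integral_cmult_indicator)
      (simp_all add: emeasure_eq_ennreal_measure e2ennreal_ereal less_top[symmetric]
        mult_ac flip: ennreal_mult'')
  finally show ?thesis .
qed

lemma ball_deficit_ge:
  fixes u :: "complex ^ 'n \<Rightarrow> ereal"
  assumes B: "\<And>w. w \<in> ball z r \<Longrightarrow> u w \<le> ereal B"
  shows "ennreal (2 * pi * measure lborel (ball (0 :: complex ^ 'n) r)) * ennreal (C - B) \<le> ball_deficit C u z r"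
proof -
  have "ennreal (2 * pi * measure lborel (ball (0 :: complex ^ 'n) r)) * ennreal (C - B) =
     (\<integral>\<^sup>+\<theta>\<in>{0..2*pi}. (\<integral>\<^sup>+y\<in>ball (0 :: complex ^ 'n) r. ennreal (C - B) \<partial>lborel) \<partial>lborel)"
    using emeasure_lborel_ball_finite[of "0 :: complex ^ 'n" r]
    by (subst nn_integral_cmult_indicator, simp, subst nn_integral_cmult_indicator)
      (simp_all add: emeasure_eq_ennreal_measure ennreal_mult' mult_ac less_top[symmetric])
  also have "\<dots> \<le> ball_deficit C u z r"
    unfolding ball_deficit_def
  proof (rule nn_integral_mono, rule mult_right_mono, rule nn_integral_mono)
    fix \<theta> and y :: "complex ^ 'n"
    show "ennreal (C - B) * indicator (ball 0 r) y \<le>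
      e2ennreal (ereal C - u (z + cis \<theta> *s y)) * indicator (ball 0 r) y"
    proof (cases "y \<in> ball 0 r")
      case True
      then have "u (z + cis \<theta> *s y) \<le> ereal B"
        by (intro B) (auto simp: dist_norm norm_vector_smult_complex)
      then have "ereal C - ereal B \<le> ereal C - u (z + cis \<theta> *s y)"
        by (intro ereal_minus_mono) auto
      from e2ennreal_mono[OF this] show ?thesis by (auto simp: e2ennreal_ereal intro: mult_right_mono)
    qed simp
  qed auto
  finally show ?thesis .
qed

lemma ball_deficit_combination:
  fixes u v :: "complex ^ 'n \<Rightarrow> ereal"
  assumes [measurable]: "u \<in> borel_measurable borel" "v \<in> borel_measurable borel"
    and c: "0 \<le> c1" "0 \<le> c2"
    and le: "\<And>w. w \<in> ball z r \<Longrightarrow> u w \<le> ereal C1" "\<And>w. w \<in> ball z r \<Longrightarrow> v w \<le> ereal C2"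
  shows "ball_deficit (c1 * C1 + c2 * C2) (\<lambda>w. ereal c1 * u w + ereal c2 * v w) z r =
    ennreal c1 * ball_deficit C1 u z r + ennreal c2 * ball_deficit C2 v z r"
proof -
  define g where "g \<theta> y = e2ennreal (ereal C1 - u (z + cis \<theta> *s y)) * indicator (ball 0 r) y" for \<theta> y
  define h where "h \<theta> y = e2ennreal (ereal C2 - v (z + cis \<theta> *s y)) * indicator (ball 0 r) y" for \<theta> y
  have [measurable]: "(\<lambda>(\<theta>, y). g \<theta> y) \<in> borel_measurable (lborel \<Otimes>\<^sub>M lborel)"
      "(\<lambda>(\<theta>, y). h \<theta> y) \<in> borel_measurable (lborel \<Otimes>\<^sub>M lborel)"
    unfolding g_def h_def by measurable
  have "e2ennreal (ereal (c1 * C1 + c2 * C2) - (ereal c1 * u (z + cis \<theta> *s y) + ereal c2 * v (z + cis \<theta> *s y)))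
       * indicator (ball 0 r) y = ennreal c1 * g \<theta> y + ennreal c2 * h \<theta> y" for \<theta> y
  proof (cases "y \<in> ball 0 r")
    case True
    then have "z + cis \<theta> *s y \<in> ball z r"
      by (auto simp: dist_norm norm_vector_smult_complex)
    from e2ennreal_deficit_combination[OF c le(1)[OF this] le(2)[OF this]] True
    show ?thesis by (simp add: g_def h_def)
  qed (simp add: g_def h_def)
  then have "ball_deficit (c1 * C1 + c2 * C2) (\<lambda>w. ereal c1 * u w + ereal c2 * v w) z r =
    (\<integral>\<^sup>+\<theta>\<in>{0..2*pi}. (\<integral>\<^sup>+y. ennreal c1 * g \<theta> y + ennreal c2 * h \<theta> y \<partial>lborel) \<partial>lborel)"
    by (simp add: ball_deficit_def)
  also have "\<dots> = (\<integral>\<^sup>+\<theta>. ennreal c1 * ((\<integral>\<^sup>+y. g \<theta> y \<partial>lborel) * indicator {0..2*pi} \<theta>) +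
      ennreal c2 * ((\<integral>\<^sup>+y. h \<theta> y \<partial>lborel) * indicator {0..2*pi} \<theta>) \<partial>lborel)"
    by (subst nn_integral_add) (auto simp: nn_integral_cmult distrib_right mult.assoc)
  also have "\<dots> = ennreal c1 * (\<integral>\<^sup>+\<theta>\<in>{0..2*pi}. (\<integral>\<^sup>+y. g \<theta> y \<partial>lborel) \<partial>lborel) +
      ennreal c2 * (\<integral>\<^sup>+\<theta>\<in>{0..2*pi}. (\<integral>\<^sup>+y. h \<theta> y \<partial>lborel) \<partial>lborel)"
    by (subst nn_integral_add) (auto simp: nn_integral_cmult)
  finally show ?thesis by (simp add: ball_deficit_def g_def h_def)
qed

section \<open>Regularized suprema are superadditive\<close>

text \<open>
  The quantitative core. The left side is a lower bound for the deficit of the combination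
  on the fixed ball around \<open>a\<close>. That deficit splits into the deficits of \<open>u\<close> and \<open>v\<close>, and each of
  these is estimated by the value at its own point, \<open>z1\<close> or \<open>z2\<close>, by comparison with a slightly larger
  ball around that point. Hence values of \<open>u\<close> and \<open>v\<close> at two different points near \<open>a\<close> control their
  combination on one ball.
\<close>

lemma ball_deficit_pair:
  fixes u v :: "complex ^ 'n \<Rightarrow> ereal"
  assumes psh: "psh_on UNIV u" "psh_on UNIV v"
    and c: "0 \<le> c1" "0 \<le> c2" and C: "0 \<le> C1" "0 \<le> C2"
    and le: "\<And>w. w \<in> ball a R \<Longrightarrow> u w \<le> ereal C1" "\<And>w. w \<in> ball a R \<Longrightarrow> v w \<le> ereal C2"
    and B: "\<And>w. w \<in> ball a r \<Longrightarrow> ereal c1 * u w + ereal c2 * v w \<le> ereal B"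
    and r: "0 < r" "0 \<le> \<eta>" "r + 2 * \<eta> \<le> R"
    and z: "dist a z1 \<le> \<eta>" "dist a z2 \<le> \<eta>" "u z1 = ereal x1" "v z2 = ereal x2"
  shows "measure lborel (ball (0 :: complex ^ 'n) r) * (c1 * C1 + c2 * C2 - B) \<le>
    measure lborel (ball (0 :: complex ^ 'n) (r + \<eta>)) * (c1 * (C1 - x1) + c2 * (C2 - x2))"
proof -
  define V where "V s = 2 * pi * measure lborel (ball (0 :: complex ^ 'n) s)" for s
  have V: "0 \<le> V s" for s by (simp add: V_def)
  have meas: "u \<in> borel_measurable borel" "v \<in> borel_measurable borel"
    using psh by (auto simp: psh_on_def intro: usc_on_UNIV_measurable)
  have sub: "ball a r \<subseteq> ball a R" "ball z1 (r + \<eta>) \<subseteq> ball a R" "ball z2 (r + \<eta>) \<subseteq> ball a R"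
    using r z(1,2) by (auto simp: ball_subset_ball_iff dist_commute)
  have "z1 \<in> ball a R" "z2 \<in> ball a R" using r z(1,2) by auto
  then have x: "x1 \<le> C1" "x2 \<le> C2" using le z(3,4) by fastforce+
  have "ennreal (V r) * ennreal (c1 * C1 + c2 * C2 - B) \<le>
      ball_deficit (c1 * C1 + c2 * C2) (\<lambda>w. ereal c1 * u w + ereal c2 * v w) a r"
    unfolding V_def by (rule ball_deficit_ge[OF B])
  also have "\<dots> = ennreal c1 * ball_deficit C1 u a r + ennreal c2 * ball_deficit C2 v a r"
    using sub(1) by (intro ball_deficit_combination meas c le) auto
  also have "\<dots> \<le> ennreal c1 * ball_deficit C1 u z1 (r + \<eta>) + ennreal c2 * ball_deficit C2 v z2 (r + \<eta>)"
    using z(1,2) by (intro add_mono mult_left_mono ball_deficit_mono meas) auto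
  also have "\<dots> \<le> ennreal c1 * (ennreal (V (r + \<eta>)) * e2ennreal (ereal C1 - u z1)) +
      ennreal c2 * (ennreal (V (r + \<eta>)) * e2ennreal (ereal C2 - v z2))"
    unfolding V_def using sub r
    by (intro add_mono mult_left_mono ball_deficit_le psh C le) (auto simp: z)
  also have "\<dots> = ennreal (c1 * (V (r + \<eta>) * (C1 - x1)) + c2 * (V (r + \<eta>) * (C2 - x2)))"
    using c x V[of "r + \<eta>"]
    by (simp add: z e2ennreal_ereal flip: ennreal_mult ennreal_plus)
  also have "c1 * (V (r + \<eta>) * (C1 - x1)) + c2 * (V (r + \<eta>) * (C2 - x2)) =
      V (r + \<eta>) * (c1 * (C1 - x1) + c2 * (C2 - x2))"
    by (simp add: algebra_simps)
  finally have "V r * (c1 * C1 + c2 * C2 - B) \<le> V (r + \<eta>) * (c1 * (C1 - x1) + c2 * (C2 - x2))"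
    using c x V[of "r + \<eta>"] V[of r] by (simp flip: ennreal_mult')
  then show ?thesis by (simp add: V_def mult.assoc)
qed

lemma usc_reg_Sup_approx:
  fixes U :: "('a :: metric_space \<Rightarrow> ereal) set"
  assumes L: "usc_reg (\<lambda>z. SUP u\<in>U. u z) a = ereal L" and "0 < \<epsilon>" "0 < \<eta>"
  obtains u z where "u \<in> U" "dist a z < \<eta>" "ereal (L - \<epsilon>) < u z"
proof -
  have "\<not> (\<forall>\<^sub>F z in nhds a. (SUP u\<in>U. u z) \<le> ereal (L - \<epsilon>))"
    using Limsup_bounded[of "\<lambda>z. SUP u\<in>U. u z" "ereal (L - \<epsilon>)" "nhds a"] L assms(2)
    by (auto simp: usc_reg_def)
  then obtain z where "dist z a < \<eta>" "ereal (L - \<epsilon>) < (SUP u\<in>U. u z)"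
    using assms(3) unfolding eventually_nhds_metric by (metis not_le)
  with that show thesis by (auto simp: less_SUP_iff dist_commute)
qed

text \<open>
  For arbitrary functions regularization is only subadditive, because the upper limits
  of the two summands may be approached along different points. For plurisubharmonic families the
  points may be different: if every combination were below some \<open>B < c1 * L1 + c2 * L2\<close> near \<open>a\<close>, then
  \<open>ball_deficit_pair\<close> with points \<open>z1\<close>, \<open>z2\<close> at distance less than \<open>\<epsilon>\<close> from \<open>a\<close> and values almost \<open>L1\<close> and
  \<open>L2\<close> would contradict this as \<open>\<epsilon>\<close> tends to \<open>0\<close>, because the volume of a ball is continuous in the radius.
\<close>

theorem usc_reg_Sup_superadditive:
  fixes U1 U2 U :: "(complex ^ 'n \<Rightarrow> ereal) set" and c1 c2 L1 L2 :: real
  assumes psh: "\<And>u. u \<in> U1 \<Longrightarrow> psh_on UNIV u" "\<And>u. u \<in> U2 \<Longrightarrow> psh_on UNIV u"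
    and c: "0 \<le> c1" "0 \<le> c2"
    and comb: "\<And>u v. u \<in> U1 \<Longrightarrow> v \<in> U2 \<Longrightarrow> (\<lambda>z. ereal c1 * u z + ereal c2 * v z) \<in> U"
    and L1: "usc_reg (\<lambda>z. SUP u\<in>U1. u z) a = ereal L1"
    and L2: "usc_reg (\<lambda>z. SUP u\<in>U2. u z) a = ereal L2"
  shows "ereal (c1 * L1 + c2 * L2) \<le> usc_reg (\<lambda>z. SUP u\<in>U. u z) a"
proof (rule ccontr)
  assume "\<not> ?thesis"
  then have "usc_reg (\<lambda>z. SUP u\<in>U. u z) a < ereal (c1 * L1 + c2 * L2)" by simp
  then obtain B where B: "usc_reg (\<lambda>z. SUP u\<in>U. u z) a < ereal B" "B < c1 * L1 + c2 * L2"
    using ereal_dense2 by fastforce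
  \<comment> \<open>bounds valid for a whole family near \<open>a\<close>, so that they do not change with \<open>\<epsilon>\<close>\<close>
  define C1 where "C1 = max 0 (L1 + 1)"
  define C2 where "C2 = max 0 (L2 + 1)"
  have "usc_reg (\<lambda>z. SUP u\<in>U1. u z) a < ereal C1" "usc_reg (\<lambda>z. SUP u\<in>U2. u z) a < ereal C2"
    using L1 L2 by (auto simp: C1_def C2_def less_max_iff_disj simp del: ereal_max)
  with B(1) have "\<forall>\<^sub>F z in nhds a. (SUP u\<in>U. u z) < ereal B \<and>
      (SUP u\<in>U1. u z) < ereal C1 \<and> (SUP u\<in>U2. u z) < ereal C2"
    unfolding usc_reg_def by (intro eventually_conj Limsup_lessD)
  then obtain R where R: "0 < R" "\<And>z. dist z a < R \<Longrightarrow> (SUP u\<in>U. u z) < ereal B \<and>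
      (SUP u\<in>U1. u z) < ereal C1 \<and> (SUP u\<in>U2. u z) < ereal C2"
    unfolding eventually_nhds_metric by blast
  have bound: "(SUP u\<in>U. u z) < ereal B" "(SUP u\<in>U1. u z) < ereal C1" "(SUP u\<in>U2. u z) < ereal C2"
    if "z \<in> ball a R" for z
    using R(2)[of z] that by (auto simp: dist_commute)
  define r where "r = R / 2"
  define V where "V s = measure lborel (ball (0 :: complex ^ 'n) s)" for s
  define rhs where "rhs \<epsilon> = V (r + \<epsilon>) * (c1 * (C1 - (L1 - \<epsilon>)) + c2 * (C2 - (L2 - \<epsilon>)))" for \<epsilon>
  have key: "V r * (c1 * C1 + c2 * C2 - B) \<le> rhs \<epsilon>" if \<epsilon>: "0 < \<epsilon>" "\<epsilon> < R / 4" for \<epsilon>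
  proof -
    obtain u z1 where u: "u \<in> U1" "dist a z1 < \<epsilon>" "ereal (L1 - \<epsilon>) < u z1"
      using usc_reg_Sup_approx[OF L1 \<epsilon>(1) \<epsilon>(1)] .
    obtain v z2 where v: "v \<in> U2" "dist a z2 < \<epsilon>" "ereal (L2 - \<epsilon>) < v z2"
      using usc_reg_Sup_approx[OF L2 \<epsilon>(1) \<epsilon>(1)] .
    have le: "u w \<le> ereal C1" "v w \<le> ereal C2" "ereal c1 * u w + ereal c2 * v w \<le> ereal B"
      if "w \<in> ball a R" for w
      using bound[OF that] SUP_upper[OF u(1), of "\<lambda>u. u w"] SUP_upper[OF v(1), of "\<lambda>u. u w"]
        SUP_upper[OF comb[OF u(1) v(1)], of "\<lambda>u. u w"] by auto
    have "z1 \<in> ball a R" "z2 \<in> ball a R" using u v \<epsilon> R(1) by auto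
    then obtain x1 x2 where x: "u z1 = ereal x1" "v z2 = ereal x2" "L1 - \<epsilon> < x1" "L2 - \<epsilon> < x2"
      using le(1)[of z1] le(2)[of z2] u(3) v(3) by (cases "u z1"; cases "v z2") auto
    have "V r * (c1 * C1 + c2 * C2 - B) \<le> V (r + \<epsilon>) * (c1 * (C1 - x1) + c2 * (C2 - x2))"
      unfolding V_def
      by (rule ball_deficit_pair[OF psh(1)[OF u(1)] psh(2)[OF v(1)] c, where a = a and R = R])
        (use le \<epsilon> u v x R(1) in \<open>auto simp: C1_def C2_def r_def\<close>)
    also have "\<dots> \<le> rhs \<epsilon>"
      unfolding rhs_def using x c by (intro mult_left_mono add_mono) (auto simp: V_def)
    finally show ?thesis .
  qed
  have "continuous_on {0..} rhs"
  proof -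
    have "rhs \<epsilon> = unit_ball_vol (DIM(complex ^ 'n)) * (r + \<epsilon>) ^ DIM(complex ^ 'n) *
        (c1 * (C1 - (L1 - \<epsilon>)) + c2 * (C2 - (L2 - \<epsilon>)))" if "0 \<le> \<epsilon>" for \<epsilon>
      using that R(1) by (simp add: rhs_def V_def content_ball r_def)
    then show ?thesis
      by (subst continuous_on_cong[OF refl]) (auto intro!: continuous_intros)
  qed
  then have "(rhs \<longlongrightarrow> rhs 0) (at_right 0)"
    by (auto simp: continuous_on_def intro: tendsto_within_subset)
  moreover have "\<forall>\<^sub>F \<epsilon> in at_right 0. V r * (c1 * C1 + c2 * C2 - B) \<le> rhs \<epsilon>"
    unfolding eventually_at_right_field using R(1) key by (intro exI[of _ "R / 4"]) auto
  ultimately have "V r * (c1 * C1 + c2 * C2 - B) \<le> rhs 0"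
    by (intro tendsto_lowerbound) auto
  then have "c1 * C1 + c2 * C2 - B \<le> c1 * (C1 - L1) + c2 * (C2 - L2)"
    using R(1) by (simp add: rhs_def V_def r_def)
  then show False using B(2) by (simp add: algebra_simps)
qed

section \<open>Extremal functions with varying growth\<close>

definition competitors ::
  "real \<Rightarrow> (complex ^ 'n) set \<Rightarrow> (complex ^ 'n \<Rightarrow> real) \<Rightarrow> (complex ^ 'n \<Rightarrow> ereal) set" where
  "competitors \<delta> K \<phi> = {u \<in> lelong_class \<delta>. \<forall>w\<in>K. u w \<le> ereal (\<phi> w)}"

lemma extremal_fun_eq_SUP: "extremal_fun \<delta> K \<phi> = (\<lambda>z. SUP u\<in>competitors \<delta> K \<phi>. u z)"
  by (simp add: extremal_fun_def competitors_def fun_eq_iff)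

lemma competitors_mono:
  assumes "\<delta> \<le> \<delta>'" "\<And>w. w \<in> K \<Longrightarrow> \<phi> w \<le> \<phi>' w"
  shows "competitors \<delta> K \<phi> \<subseteq> competitors \<delta>' K \<phi>'"
proof -
  have "u \<in> lelong_class \<delta>'" if lelong: "u \<in> lelong_class \<delta>" for u :: "complex ^ 'a \<Rightarrow> ereal"
  proof -
    obtain C where "\<And>z. u z \<le> ereal (\<delta> * log_plus (norm z) + C)"
      using lelong by (auto simp: lelong_class_def)
    moreover have "\<delta> * log_plus (norm z) \<le> \<delta>' * log_plus (norm z)" for z :: "complex ^ 'a"
      using assms(1) by (intro mult_right_mono) (auto simp: log_plus_def)
    ultimately have "u z \<le> ereal (\<delta>' * log_plus (norm z) + C)" for z
      by (meson add_right_mono ereal_less_eq(3) order_trans)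
    then show ?thesis using lelong by (auto simp: lelong_class_def)
  qed
  then show ?thesis using assms(2) by (fastforce simp: competitors_def intro: order_trans)
qed

lemma competitors_const:
  assumes "0 \<le> \<delta>" "\<And>w. w \<in> K \<Longrightarrow> k \<le> \<phi> w"
  shows "(\<lambda>_. ereal k) \<in> competitors \<delta> K \<phi>"
  using assms by (auto simp: competitors_def lelong_class_def psh_on_UNIV_const log_plus_def
      intro!: exI[of _ k])

lemma competitors_combination:
  assumes u: "u \<in> competitors \<delta>1 K \<phi>1" and v: "v \<in> competitors \<delta>2 K \<phi>2"
    and c: "0 \<le> c1" "0 \<le> c2"
  shows "(\<lambda>z. ereal c1 * u z + ereal c2 * v z) \<in>
    competitors (c1 * \<delta>1 + c2 * \<delta>2) K (\<lambda>w. c1 * \<phi>1 w + c2 * \<phi>2 w)"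
proof -
  obtain C1 where C1: "\<And>z. u z \<le> ereal (\<delta>1 * log_plus (norm z) + C1)"
    using u by (auto simp: competitors_def lelong_class_def)
  obtain C2 where C2: "\<And>z. v z \<le> ereal (\<delta>2 * log_plus (norm z) + C2)"
    using v by (auto simp: competitors_def lelong_class_def)
  have "ereal c1 * u z + ereal c2 * v z \<le>
      ereal ((c1 * \<delta>1 + c2 * \<delta>2) * log_plus (norm z) + (c1 * C1 + c2 * C2))" for z
    using ereal_combination_mono[OF c C1 C2, of z z] by (simp add: algebra_simps)
  moreover have "ereal c1 * u z + ereal c2 * v z \<le> ereal (c1 * \<phi>1 z + c2 * \<phi>2 z)" if "z \<in> K" for z
    using ereal_combination_mono[OF c, of "u z" "ereal (\<phi>1 z)" "v z" "ereal (\<phi>2 z)"] u v that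
    by (simp add: competitors_def)
  ultimately show ?thesis
    using u v c by (auto simp: competitors_def lelong_class_def intro: psh_on_UNIV_combination)
qed

lemma extremal_fun_reg_mono:
  assumes "\<delta> \<le> \<delta>'" "\<And>w. w \<in> K \<Longrightarrow> \<phi> w \<le> \<phi>' w"
  shows "extremal_fun_reg \<delta> K \<phi> z \<le> extremal_fun_reg \<delta>' K \<phi>' z"
  unfolding extremal_fun_reg_def usc_reg_def extremal_fun_eq_SUP
  by (intro Limsup_mono always_eventually allI SUP_subset_mono competitors_mono assms order_refl)

lemma extremal_fun_le_reg: "extremal_fun \<delta> K \<phi> z \<le> extremal_fun_reg \<delta> K \<phi> z"
  unfolding extremal_fun_reg_def usc_reg_def Limsup_def
  by (rule INF_greatest) (auto dest: eventually_nhds_x_imp_x intro: SUP_upper)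

text \<open>
  All the relations between different growth rates \<open>\<delta>\<close> and different obstacles come from one fact:
  combinations of competitors compete for the combined growth and the combined obstacle.
\<close>

lemma extremal_fun_reg_superadditive:
  assumes "0 \<le> c1" "0 \<le> c2"
    and "extremal_fun_reg \<delta>1 K \<phi>1 a = ereal L1" "extremal_fun_reg \<delta>2 K \<phi>2 a = ereal L2"
  shows "ereal (c1 * L1 + c2 * L2) \<le>
    extremal_fun_reg (c1 * \<delta>1 + c2 * \<delta>2) K (\<lambda>w. c1 * \<phi>1 w + c2 * \<phi>2 w) a"
  unfolding extremal_fun_reg_def extremal_fun_eq_SUP
  by (rule usc_reg_Sup_superadditive[OF _ _ assms(1,2) competitors_combination[OF _ _ assms(1,2)]])
    (use assms(3,4) in \<open>auto simp: competitors_def lelong_class_def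
       extremal_fun_reg_def extremal_fun_eq_SUP\<close>)

lemma extremal_fun_reg_ge_const:
  assumes "0 \<le> \<delta>" "\<And>w. w \<in> K \<Longrightarrow> k \<le> \<phi> w"
  shows "ereal k \<le> extremal_fun_reg \<delta> K \<phi> z"
proof -
  have "ereal k \<le> extremal_fun \<delta> K \<phi> z"
    unfolding extremal_fun_eq_SUP by (rule SUP_upper2[OF competitors_const[OF assms]]) auto
  then show ?thesis using extremal_fun_le_reg order_trans by blast
qed

text \<open>
  When the second competitor is a constant, the combination is an affine operation, which commutes
  with suprema and upper limits. In this case no finiteness at the point is required, and the
  inequality can be used to prove finiteness.
\<close>

lemma extremal_fun_reg_affine:
  assumes c: "0 < c"
  shows "ereal c * extremal_fun_reg \<delta> K \<phi> z + ereal k \<le>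
    extremal_fun_reg (c * \<delta>) K (\<lambda>w. c * \<phi> w + k) z"
proof -
  have le: "ereal c * extremal_fun \<delta> K \<phi> z + ereal k \<le> extremal_fun (c * \<delta>) K (\<lambda>w. c * \<phi> w + k) z"
    (is "_ \<le> ?V") for z
  proof -
    have "ereal c * u z + ereal k \<le> ?V" if "u \<in> competitors \<delta> K \<phi>" for u
      using competitors_combination[OF that competitors_const[of 0 K k "\<lambda>_. k"], of c 1] c
      unfolding extremal_fun_eq_SUP by (auto intro: SUP_upper2)
    then have "u z \<le> (?V - ereal k) / ereal c" if "u \<in> competitors \<delta> K \<phi>" for u
      using c that by (simp add: ereal_le_divide_pos ereal_le_minus)
    then have "extremal_fun \<delta> K \<phi> z \<le> (?V - ereal k) / ereal c"
      by (subst extremal_fun_eq_SUP) (auto intro: SUP_least)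
    then show ?thesis using c by (simp add: ereal_le_divide_pos ereal_le_minus)
  qed
  have "ereal c * extremal_fun_reg \<delta> K \<phi> z + ereal k =
      Limsup (nhds z) (\<lambda>z. ereal c * extremal_fun \<delta> K \<phi> z + ereal k)"
    unfolding extremal_fun_reg_def usc_reg_def
    using c by (simp add: Limsup_add_ereal_right Limsup_ereal_mult_left)
  also have "\<dots> \<le> extremal_fun_reg (c * \<delta>) K (\<lambda>w. c * \<phi> w + k) z"
    unfolding extremal_fun_reg_def usc_reg_def
    by (intro Limsup_mono always_eventually allI le)
  finally show ?thesis .
qed

lemma extremal_fun_reg_concave:
  assumes "0 \<le> t" "t \<le> 1"
    and "extremal_fun_reg \<delta>0 K \<phi> a = ereal L0" "extremal_fun_reg \<delta>1 K \<phi> a = ereal L1"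
  shows "ereal ((1 - t) * L0 + t * L1) \<le> extremal_fun_reg ((1 - t) * \<delta>0 + t * \<delta>1) K \<phi> a"
proof -
  have "(\<lambda>w. (1 - t) * \<phi> w + t * \<phi> w) = \<phi>" by (simp add: algebra_simps)
  then show ?thesis
    using extremal_fun_reg_superadditive[OF _ assms(1,3,4), of "1 - t"] assms(2) by simp
qed

text \<open>
  Concavity between growth \<open>\<delta>\<close> and growth \<open>0\<close>, where the constant \<open>m\<close> takes the place of the extremal
  function.
\<close>

lemma extremal_fun_reg_contract:
  assumes c: "0 < c" "c \<le> 1" and m: "\<And>w. w \<in> K \<Longrightarrow> m \<le> \<phi> w"
  shows "ereal c * extremal_fun_reg \<delta> K \<phi> z + ereal ((1 - c) * m) \<le> extremal_fun_reg (c * \<delta>) K \<phi> z"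
proof -
  have le: "c * \<phi> w + (1 - c) * m \<le> \<phi> w" if "w \<in> K" for w
    using mult_left_mono[OF m[OF that], of "1 - c"] c by (simp add: algebra_simps)
  have "ereal c * extremal_fun_reg \<delta> K \<phi> z + ereal ((1 - c) * m) \<le>
      extremal_fun_reg (c * \<delta>) K (\<lambda>w. c * \<phi> w + (1 - c) * m) z"
    by (rule extremal_fun_reg_affine[OF c(1)])
  also have "\<dots> \<le> extremal_fun_reg (c * \<delta>) K \<phi> z"
    by (rule extremal_fun_reg_mono[OF order_refl le])
  finally show ?thesis .
qed

section \<open>The right derivative of the extremal function\<close>

lemma tendsto_SUP_at_right:
  fixes f :: "real \<Rightarrow> real"
  assumes anti: "\<And>h h'. 0 < h \<Longrightarrow> h \<le> h' \<Longrightarrow> f h' \<le> f h" and bdd: "bdd_above (f ` {0<..})"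
  shows "(f \<longlongrightarrow> (SUP h\<in>{0<..}. f h)) (at_right 0)"
proof (rule order_tendstoI)
  fix y assume "y < (SUP h\<in>{0<..}. f h)"
  then obtain h where h: "0 < h" "y < f h"
    using less_cSUP_iff[OF _ bdd] by auto
  then have "y < f h'" if "0 < h'" "h' < h" for h'
    using anti[of h' h] that by linarith
  then show "\<forall>\<^sub>F h in at_right 0. y < f h"
    unfolding eventually_at_right_field using h by blast
next
  fix y assume y: "(SUP h\<in>{0<..}. f h) < y"
  have "f h < y" if "0 < h" for h
    using cSUP_upper[OF _ bdd, of h] that y by simp
  then show "\<forall>\<^sub>F h in at_right 0. f h < y"
    unfolding eventually_at_right_field by (intro exI[of _ 1]) auto
qed

theorem proposition3p2:
  fixes K :: "(complex ^ 'n) set" and \<psi> :: "complex ^ 'n \<Rightarrow> real"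
    and a :: "complex ^ 'n" and \<tau> m M :: real
    and F :: "real \<Rightarrow> ereal" and Q :: "real \<Rightarrow> ereal" and D VK :: ereal
  defines "m \<equiv> (INF z\<in>K. \<psi> z)" and "M \<equiv> (SUP z\<in>K. \<psi> z)"
    and "F \<equiv> (\<lambda>\<delta>. extremal_fun_reg \<delta> K \<psi> a)"
    and "Q \<equiv> extremal_quotient \<tau> a K \<psi>"
    and "D \<equiv> extremal_right_deriv \<tau> a K \<psi>"
    and "VK \<equiv> usc_reg (siciak_fun K) a"
  assumes "compact K" and "\<not> pluripolar K" and "bounded (\<psi> ` K)" and "a \<in> K"
    and "\<tau> \<in> Lambda_reg a K \<psi>"
  shows "(Q \<longlongrightarrow> D) (at_right 0) \<and> \<bar>D\<bar> \<noteq> \<infinity> \<and>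
    antimono_on {0<..} Q \<and>
    (\<forall>h>0. VK \<le> Q h \<and> Q h \<le> D \<and> D \<le> ereal ((\<psi> a - m) / \<tau>)) \<and>
    (Q \<longlongrightarrow> VK) at_top \<and>
    (\<forall>h>0. 0 \<le> Q h - VK \<and> Q h - VK \<le> ereal ((M - m) / h)) \<and>
    (D = VK \<longleftrightarrow> (\<forall>\<delta>\<ge>\<tau>. F \<delta> = ereal (\<psi> a) + ereal (\<delta> - \<tau>) * VK)) \<and>
    ((\<forall>\<delta>>\<tau>. F \<delta> = ereal (\<psi> a)) \<longleftrightarrow> D = 0) \<and>
    (D > 0 \<longrightarrow> (\<forall>\<delta>>\<tau>. F \<delta> \<noteq> ereal (\<psi> a)) \<and>
      \<tau> \<in> Lambda_set K \<psi> \<and> (\<forall>\<delta>\<in>Lambda_set K \<psi>. \<tau> \<le> \<delta>))"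
proof -
  have m: "m \<le> \<psi> w" and M: "\<psi> w \<le> M" if "w \<in> K" for w
    unfolding m_def M_def
    using cINF_lower[OF bounded_imp_bdd_below that] cSUP_upper[OF that bounded_imp_bdd_above]
      \<open>bounded (\<psi> ` K)\<close> by blast+
  define p where "p = \<psi> a"
  have \<tau>: "0 < \<tau>" "\<tau> \<in> Lambda_set K \<psi>" and F\<tau>: "F \<tau> = ereal p"
    using \<open>\<tau> \<in> Lambda_reg a K \<psi>\<close> by (auto simp: Lambda_reg_def Lambda_set_def F_def p_def)
  have VK_eq: "VK = extremal_fun_reg 1 K (\<lambda>_. 0) a"
    by (simp add: VK_def siciak_fun_def extremal_fun_reg_def)

  \<comment> \<open>A value for large growth is pulled back to growth \<open>\<tau>\<close> by mixing with the constant \<open>m\<close>; since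
    \<open>F \<tau>\<close> is finite, so is every value of \<open>F\<close>.\<close>
  have F_ge: "ereal m \<le> F \<delta>" if "0 < \<delta>" for \<delta>
    unfolding F_def using that m by (intro extremal_fun_reg_ge_const) auto
  have F_mono: "F \<delta> \<le> F \<delta>'" if "\<delta> \<le> \<delta>'" for \<delta> \<delta>'
    unfolding F_def using that by (intro extremal_fun_reg_mono) auto
  have F_contract: "ereal (\<tau> / \<delta>) * F \<delta> + ereal ((1 - \<tau> / \<delta>) * m) \<le> ereal p" if "\<tau> \<le> \<delta>" for \<delta>
  proof -
    have c: "0 < \<tau> / \<delta>" "\<tau> / \<delta> \<le> 1" "\<tau> / \<delta> * \<delta> = \<tau>" using that \<tau>(1) by auto
    show ?thesis
      using extremal_fun_reg_contract[OF c(1,2), where K = K and m = m and \<phi> = \<psi> and \<delta> = \<delta> and z = a, OF m] F\<tau>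
      unfolding c(3) F_def by simp
  qed
  have F_finite: "\<bar>F \<delta>\<bar> \<noteq> \<infinity>" if "0 < \<delta>" for \<delta>
  proof -
    obtain \<delta>' where \<delta>': "\<delta> \<le> \<delta>'" "\<tau> \<le> \<delta>'" by (meson linear order_refl)
    then have "0 < \<tau> / \<delta>'" using \<tau>(1) by simp
    then have "F \<delta>' \<noteq> \<infinity>" using F_contract[OF \<delta>'(2)] by (cases "F \<delta>'") (auto simp: zero_less_divide_iff)
    then have "F \<delta> \<noteq> \<infinity>" using F_mono[OF \<delta>'(1)] by force
    then show ?thesis using F_ge[OF that] by (cases "F \<delta>") auto
  qed
  define G where "G \<delta> = real_of_ereal (F \<delta>)" for \<delta>
  have F: "F \<delta> = ereal (G \<delta>)" if "0 < \<delta>" for \<delta>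
    using F_finite[OF that] by (simp add: G_def ereal_real')
  have G\<tau>: "G \<tau> = p" using F\<tau> by (simp add: G_def)
  have G_mono: "G \<delta> \<le> G \<delta>'" if "0 < \<delta>" "\<delta> \<le> \<delta>'" for \<delta> \<delta>'
    using F_mono[OF that(2)] F that by simp
  have G_concave: "(1 - t) * G \<delta>0 + t * G \<delta>1 \<le> G ((1 - t) * \<delta>0 + t * \<delta>1)"
    if "0 < \<delta>0" "0 < \<delta>1" "0 \<le> t" "t \<le> 1" for t \<delta>0 \<delta>1
  proof -
    have "0 < (1 - t) * \<delta>0 + t * \<delta>1"
      using convexD_alt[OF convex_real_interval(3)[of 0], of \<delta>0 \<delta>1 t] that by simp
    then show ?thesis
      using extremal_fun_reg_concave[OF that(3,4), of \<delta>0 K \<psi> a "G \<delta>0" \<delta>1 "G \<delta>1"] F that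
      by (simp add: F_def)
  qed

  \<comment> \<open>Scaling the competitors for \<open>VK\<close> by \<open>\<tau>\<close> and adding \<open>m\<close> gives competitors for \<open>F \<tau>\<close>. The reverse
    normalization, subtracting \<open>M\<close> and dividing by the growth, bounds \<open>F\<close> from above by \<open>VK\<close>.\<close>
  have VK_nonneg: "0 \<le> VK"
    using extremal_fun_reg_ge_const[of 1 K 0 "\<lambda>_. 0" a] by (simp add: VK_eq zero_ereal_def)
  have VK_le: "ereal \<tau> * VK + ereal m \<le> ereal p"
    using extremal_fun_reg_affine[OF \<tau>(1), of 1 K "\<lambda>_. 0" a m]
      extremal_fun_reg_mono[of \<tau> \<tau> K "\<lambda>_. m" \<psi> a] m F\<tau>
    by (auto simp: VK_eq F_def intro: order_trans)
  obtain k where k: "VK = ereal k" "0 \<le> k"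
    using VK_le VK_nonneg \<tau>(1) by (cases VK) auto
  have k_le: "\<tau> * k \<le> p - m" using VK_le k by simp
  have G_lower: "p + h * k \<le> G (\<tau> + h)" if "0 < h" for h
    using extremal_fun_reg_superadditive[of 1 h \<tau> K \<psi> a p 1 "\<lambda>_. 0" k] that F[of "\<tau> + h"] F\<tau> k \<tau>(1)
    by (simp add: F_def VK_eq)
  have G_upper: "G (\<tau> + h) \<le> M + (\<tau> + h) * k" if "0 < h" for h
  proof -
    define s where "s = \<tau> + h"
    have s: "0 < s" using that \<tau>(1) by (simp add: s_def)
    have "ereal (1 / s) * F s + ereal (- M / s) \<le> extremal_fun_reg 1 K (\<lambda>w. 1 / s * \<psi> w + - M / s) a"
      using extremal_fun_reg_affine[of "1 / s" s K \<psi> a "- M / s"] s by (simp add: F_def)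
    also have "\<dots> \<le> VK"
      unfolding VK_eq using M s by (intro extremal_fun_reg_mono) (auto simp: field_simps)
    finally show ?thesis
      using F[OF s] k s by (simp add: s_def[symmetric] field_simps)
  qed
  have G_slope: "\<tau> * (G (\<tau> + h) - p) \<le> h * (p - m)" if "0 < h" for h
  proof -
    have "\<tau> / (\<tau> + h) * G (\<tau> + h) + (1 - \<tau> / (\<tau> + h)) * m \<le> p"
      using F_contract[of "\<tau> + h"] F[of "\<tau> + h"] that \<tau>(1) by simp
    moreover have "1 - \<tau> / (\<tau> + h) = h / (\<tau> + h)"
      using that \<tau>(1) by (simp add: field_simps)
    ultimately have "(\<tau> * G (\<tau> + h) + h * m) / (\<tau> + h) \<le> p"
      by (simp add: add_divide_distrib)
    then have "\<tau> * G (\<tau> + h) + h * m \<le> p * (\<tau> + h)"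
      using that \<tau>(1) by (simp add: pos_divide_le_eq)
    then show ?thesis by (simp add: algebra_simps)
  qed

  define q where "q h = (G (\<tau> + h) - p) / h" for h
  have Q: "Q h = ereal (q h)" if "0 < h" for h
    using F[of "\<tau> + h"] that \<tau>(1)
    by (simp add: Q_def q_def extremal_quotient_def F_def p_def)
  have q_anti: "q h' \<le> q h" if "0 < h" "h \<le> h'" for h h'
  proof -
    have "(1 - h / h') * \<tau> + h / h' * (\<tau> + h') = \<tau> + h" using that by (simp add: field_simps)
    then have "(1 - h / h') * p + h / h' * G (\<tau> + h') \<le> G (\<tau> + h)"
      using G_concave[of \<tau> "\<tau> + h'" "h / h'"] that \<tau>(1) G\<tau> by simp
    then show ?thesis using that by (simp add: q_def field_simps)
  qed
  have q_ge: "k \<le> q h" if "0 < h" for h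
    using G_lower[OF that] that by (simp add: q_def field_simps)
  have q_le: "q h \<le> (p - m) / \<tau>" if "0 < h" for h
    using G_slope[OF that] that \<tau>(1) by (simp add: q_def field_simps)
  have q_error: "q h - k \<le> (M - m) / h" if "0 < h" for h
  proof -
    have "G (\<tau> + h) - p - h * k \<le> M - m"
      using G_upper[OF that] k_le by (simp add: algebra_simps)
    then have "(G (\<tau> + h) - p - h * k) / h \<le> (M - m) / h"
      using that by (intro divide_right_mono) auto
    then show ?thesis using that by (simp add: q_def diff_divide_distrib)
  qed
  define d where "d = (SUP h\<in>{0<..}. q h)"
  have bdd: "bdd_above (q ` {0<..})" using q_le by (auto simp: bdd_above_def)
  have q_le_d: "q h \<le> d" if "0 < h" for h
    unfolding d_def using that bdd by (intro cSUP_upper) auto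
  have d_le: "d \<le> (p - m) / \<tau>"
    unfolding d_def using q_le by (intro cSUP_least) auto
  have d_least: "d \<le> c" if "\<And>h. 0 < h \<Longrightarrow> q h \<le> c" for c
    unfolding d_def using that by (intro cSUP_least) auto

  have "(q \<longlongrightarrow> d) (at_right 0)"
    unfolding d_def by (rule tendsto_SUP_at_right[OF q_anti bdd])
  moreover have "\<forall>\<^sub>F h in at_right 0. ereal (q h) = Q h"
    unfolding eventually_at_right_field using Q by (intro exI[of _ 1]) auto
  ultimately have Q_lim: "(Q \<longlongrightarrow> ereal d) (at_right 0)"
    by (blast intro: Lim_transform_eventually tendsto_ereal)
  then have D: "D = ereal d"
    unfolding D_def extremal_right_deriv_def Q_def[symmetric] by (intro tendsto_Lim) auto

  have "(q \<longlongrightarrow> k) at_top"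
  proof (rule real_tendsto_sandwich[of "\<lambda>_. k" _ _ "\<lambda>h. k + (M - m) / h"])
    show "((\<lambda>h. k + (M - m) / h) \<longlongrightarrow> k) at_top"
    proof -
      have "((\<lambda>h. (M - m) / h) \<longlongrightarrow> 0) at_top"
        by (rule tendsto_divide_0[OF tendsto_const])
          (rule filterlim_at_top_imp_at_infinity[OF filterlim_ident])
      from tendsto_add[OF tendsto_const this, of k] show ?thesis by simp
    qed
    show "\<forall>\<^sub>F h in at_top. k \<le> q h"
      using eventually_gt_at_top[of 0] by eventually_elim (rule q_ge)
    show "\<forall>\<^sub>F h in at_top. q h \<le> k + (M - m) / h"
      using eventually_gt_at_top[of 0] by eventually_elim (use q_error in \<open>force simp: algebra_simps\<close>)
  qed simp
  moreover have "\<forall>\<^sub>F h in at_top. ereal (q h) = Q h"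
    using eventually_gt_at_top[of 0] by eventually_elim (simp add: Q)
  ultimately have Q_top: "(Q \<longlongrightarrow> VK) at_top"
    unfolding k(1) by (blast intro: Lim_transform_eventually tendsto_ereal)

  have Fq: "F (\<tau> + h) = ereal (p + h * q h)" if "0 < h" for h
    using F[of "\<tau> + h"] that \<tau>(1) by (simp add: q_def)
  have linear_iff: "D = VK \<longleftrightarrow> (\<forall>\<delta>\<ge>\<tau>. F \<delta> = ereal (\<psi> a) + ereal (\<delta> - \<tau>) * VK)"
  proof
    assume "D = VK"
    then have "q h = k" if "0 < h" for h
      using q_ge[OF that] q_le_d[OF that] D k by simp
    then have "F \<delta> = ereal (\<psi> a) + ereal (\<delta> - \<tau>) * VK" if "\<tau> < \<delta>" for \<delta>
      using Fq[of "\<delta> - \<tau>"] that k by (simp add: p_def)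
    then show "\<forall>\<delta>\<ge>\<tau>. F \<delta> = ereal (\<psi> a) + ereal (\<delta> - \<tau>) * VK"
      using F\<tau> k by (auto simp: p_def le_less)
  next
    assume lin: "\<forall>\<delta>\<ge>\<tau>. F \<delta> = ereal (\<psi> a) + ereal (\<delta> - \<tau>) * VK"
    have "q h = k" if "0 < h" for h
      using lin[rule_format, of "\<tau> + h"] Fq[OF that] that k by (simp add: p_def)
    then have "d = k" using d_least[of k] q_le_d[of 1] by force
    then show "D = VK" using D k by simp
  qed
  \<comment> \<open>If \<open>F\<close> returns to \<open>p\<close> at \<open>\<tau> + h\<close>, then it equals \<open>p\<close> on the way by monotonicity and stays at
    most \<open>p\<close> beyond by concavity.\<close>
  have d_zero: "d \<le> 0" if "0 < h" "F (\<tau> + h) = ereal p" for h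
  proof (rule d_least)
    fix h' :: real assume h': "0 < h'"
    have "q h' = 0 \<or> q h' \<le> q h"
    proof (cases "h \<le> h'")
      case False
      have "G (\<tau> + h) = p" using F[of "\<tau> + h"] that \<tau>(1) by simp
      then have "G (\<tau> + h') = p"
        using G_mono[of \<tau> "\<tau> + h'"] G_mono[of "\<tau> + h'" "\<tau> + h"] False h' G\<tau> \<tau>(1) by force
      then show ?thesis by (simp add: q_def)
    qed (use q_anti that in auto)
    moreover have "q h = 0" using Fq[OF that(1)] that by simp
    ultimately show "q h' \<le> 0" by auto
  qed
  have d_nonneg: "0 \<le> d" using q_ge[of 1] q_le_d[of 1] k(2) by simp
  have const_iff: "(\<forall>\<delta>>\<tau>. F \<delta> = ereal (\<psi> a)) \<longleftrightarrow> D = 0"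
  proof
    assume "\<forall>\<delta>>\<tau>. F \<delta> = ereal (\<psi> a)"
    then show "D = 0" using d_zero[of 1] d_nonneg D by (simp add: p_def)
  next
    assume "D = 0"
    then have "q h = 0" if "0 < h" for h
      using q_ge[OF that] q_le_d[OF that] D k(2) by simp
    then show "\<forall>\<delta>>\<tau>. F \<delta> = ereal (\<psi> a)"
      using Fq[of "\<delta> - \<tau>" for \<delta>] by (force simp: p_def)
  qed
  \<comment> \<open>A smaller element \<open>\<delta>\<close> would give \<open>F \<delta> \<ge> p = F \<tau>\<close>, and a concave function that does not increase
    from \<open>\<delta>\<close> to \<open>\<tau>\<close> does not increase after \<open>\<tau>\<close> either.\<close>
  have minimal: "\<tau> \<le> \<delta>" if "0 < d" "\<delta> \<in> Lambda_set K \<psi>" for \<delta>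
  proof (rule ccontr)
    assume "\<not> \<tau> \<le> \<delta>"
    have \<delta>: "0 < \<delta>" "\<delta> < \<tau>" "extremal_fun \<delta> K \<psi> a = ereal p"
      using that(2) \<open>a \<in> K\<close> \<open>\<not> \<tau> \<le> \<delta>\<close> by (auto simp: Lambda_set_def p_def)
    have "ereal p \<le> F \<delta>"
      using extremal_fun_le_reg[of \<delta> K \<psi> a] \<delta>(3) by (simp add: F_def)
    then have G\<delta>: "p \<le> G \<delta>" using F[OF \<delta>(1)] by simp
    have "q h \<le> 0" if h: "0 < h" for h
    proof -
      \<comment> \<open>the weight that makes \<open>\<tau>\<close> the combination of \<open>\<delta>\<close> and \<open>\<tau> + h\<close>\<close>
      define t where "t = (\<tau> - \<delta>) / (\<tau> + h - \<delta>)"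
      have t: "0 < t" "t \<le> 1" using \<delta> h by (auto simp: t_def)
      have "t * (\<tau> + h - \<delta>) = \<tau> - \<delta>" using \<delta> h by (simp add: t_def)
      then have "(1 - t) * \<delta> + t * (\<tau> + h) = \<tau>" by (simp add: algebra_simps)
      then have "(1 - t) * G \<delta> + t * G (\<tau> + h) \<le> p"
        using G_concave[of \<delta> "\<tau> + h" t] t \<delta> h G\<tau> by simp
      moreover have "(1 - t) * p \<le> (1 - t) * G \<delta>" using G\<delta> t by (intro mult_left_mono) auto
      ultimately have "t * (G (\<tau> + h) - p) \<le> 0" by (simp add: algebra_simps)
      then have "G (\<tau> + h) \<le> p" using t by (simp add: mult_le_0_iff)
      then show ?thesis using h by (simp add: q_def divide_le_0_iff)
    qed
    then show False using d_least[of 0] that(1) by force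
  qed
  have nonconst: "F \<delta> \<noteq> ereal (\<psi> a)" if "0 < d" "\<tau> < \<delta>" for \<delta>
    using d_zero[of "\<delta> - \<tau>"] that by (auto simp: p_def)
  have "antimono_on {0<..} Q"
    by (rule monotone_onI) (use Q q_anti in auto)
  moreover have "VK \<le> Q h \<and> Q h \<le> D \<and> D \<le> ereal ((\<psi> a - m) / \<tau>)" if "0 < h" for h
    using q_ge q_le_d d_le that by (simp add: Q D k p_def)
  moreover have "0 \<le> Q h - VK \<and> Q h - VK \<le> ereal ((M - m) / h)" if "0 < h" for h
    using q_ge q_error that by (simp add: Q k)
  ultimately show ?thesis
    using Q_lim Q_top linear_iff const_iff nonconst minimal \<tau>(2) by (auto simp: D)
qed

end
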